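(* Let $\mathcal{H}$ be a real Hilbert space and let $f\in\Gamma_0(\mathcal{H})$ be a $\kappa$-smooth $\rho$-strongly convex function with $\kappa>\rho>0$. Let $\beta\in\big(\frac{\kappa-\rho}{\kappa+\rho},1\big)$ and let $T:=\nabla\psi:\mathcal{H}\to\mathcal{H}$, where $\psi:\mathcal{H}\to\mathbb{R}$ is a Fréchet differentiable convex function whose gradient $\nabla\psi$ is $\beta^{-1}$-Lipschitz continuous. Let $\mu\in\big[\frac{1-\beta}{\rho},\frac{1+\beta}{\kappa}\big)$ and $\varphi:=\psi^{*}-\frac12\|\cdot\|^2$. Then the following hold. 1) Let $\hat{f}:=f-\frac{1-\beta}{2\mu}\|\cdot\|^2$ and $\check{\varphi}:=\varphi+\frac{1-\beta}{2}\|\cdot\|^2$; both belong to $\Gamma_0(\mathcal{H})$, and $\mu\hat{f}+\check{\varphi}=\mu f+\varphi$. Then $$T\circ(\mathrm{Id}-\mu\nabla f)=\mathrm{s\text{-}Prox}_{\beta^{-1}\check{\varphi}}\circ(\mathrm{Id}-\beta^{-1}\mu\nabla\hat{f})$$ with $\beta^{-1}\in(1,2/L_{\mu\nabla\hat{f}})$, where $L_{\mu\nabla\hat{f}}:=\mu\kappa-(1-\beta)>0$ is the Lipschitz constant of $\mu\nabla\hat{f}$ (i.e. $\mu\nabla\hat f$ is Lipschitz continuous with constant $L_{\mu\nabla\hat f}$). 2) Suppose that $\mu f+\varphi$ has a minimizer in $\mathcal{H}$. Then, for an arbitrary $x_0\in\mathcal{H}$, the sequence $(x_k)_{k\in\mathbb{N}}\subset\mathcal{H}$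 generated by $$x_{k+1}:=T\big(x_k-\mu\nabla f(x_k)\big),\quad k\in\mathbb{N},$$ converges weakly to a minimizer $\hat{x}\in\mathcal{H}$ of $\mu f+\varphi$.
   Context: $\Gamma_0(\mathcal{H})$ is the set of proper lower semicontinuous convex functions $\mathcal{H}\to(-\infty,+\infty]$. A function is $\kappa$-smooth if it is real-valued and differentiable on all of $\mathcal{H}$ with $\kappa$-Lipschitz continuous gradient. $f$ is $\rho$-strongly convex if $f-\frac{\rho}{2}\|\cdot\|^2$ is convex. The Fenchel conjugate is $\psi^*(x):=\sup_{y\in\mathcal{H}}[\langle x,y\rangle-\psi(y)]$. For $h\in\Gamma_0(\mathcal{H})$, $\mathrm{s\text{-}Prox}_h(x):=\operatorname{argmin}_{y\in\mathcal{H}}\big(h(y)+\frac12\|x-y\|^2\big)$ is Moreau's proximity operator. An operator $T=\nabla\psi$ with $\psi$ convex and $\beta^{-1}$-smooth, $\beta\in(0,1)$, is called a monotone Lipschitz-gradient (MoL-Grad) denoiser. $\mathbb{N}$ denotes the nonnegative integers. *)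

theory Defs
  imports "HOL-Analysis.Analysis"
begin

text \<open>
  A real Hilbert space is a type of sort \<open>{real_inner, complete_space}\<close>.
  Functions with values in \<open>(-\<infinity>, +\<infinity>]\<close> are functions into \<^typ>\<open>ereal\<close>; that they avoid
  \<open>-\<infinity>\<close> is part of properness.
\<close>

definition proper_fun :: "('a \<Rightarrow> ereal) \<Rightarrow> bool" where
  "proper_fun h \<longleftrightarrow> (\<forall>x. h x \<noteq> -\<infinity>) \<and> (\<exists>x. h x \<noteq> \<infinity>)"

definition lower_semicontinuous :: "('a::topological_space \<Rightarrow> ereal) \<Rightarrow> bool" where
  "lower_semicontinuous h \<longleftrightarrow> (\<forall>x. h x \<le> Liminf (at x) h)"

text \<open>
  Only used together with \<^const>\<open>proper_fun\<close>, so the sum on the right-hand side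
  never takes the form \<open>\<infinity> + (-\<infinity>)\<close>.
\<close>

definition convex_ereal :: "('a::real_vector \<Rightarrow> ereal) \<Rightarrow> bool" where
  "convex_ereal h \<longleftrightarrow>
    (\<forall>x y. \<forall>u>0. \<forall>v>0. u + v = 1 \<longrightarrow>
      h (u *\<^sub>R x + v *\<^sub>R y) \<le> ereal u * h x + ereal v * h y)"

definition Gamma0 :: "('a::real_inner \<Rightarrow> ereal) set" where
  "Gamma0 = {h. proper_fun h \<and> lower_semicontinuous h \<and> convex_ereal h}"

definition gradient :: "('a::real_inner \<Rightarrow> real) \<Rightarrow> 'a \<Rightarrow> 'a" where
  "gradient f x = (THE D. GDERIV f x :> D)"

definition smooth_fun :: "real \<Rightarrow> ('a::real_inner \<Rightarrow> real) \<Rightarrow> bool" where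
  "smooth_fun \<kappa> f \<longleftrightarrow>
    (\<forall>x. f differentiable (at x)) \<and> \<kappa>-lipschitz_on UNIV (gradient f)"

definition strongly_convex :: "real \<Rightarrow> ('a::real_inner \<Rightarrow> real) \<Rightarrow> bool" where
  "strongly_convex \<rho> f \<longleftrightarrow> convex_on UNIV (\<lambda>x. f x - \<rho> / 2 * (norm x)\<^sup>2)"

definition fenchel_conjugate :: "('a::real_inner \<Rightarrow> ereal) \<Rightarrow> 'a \<Rightarrow> ereal" where
  "fenchel_conjugate \<psi> x = (SUP y. ereal (x \<bullet> y) - \<psi> y)"

definition minimizers :: "('a \<Rightarrow> ereal) \<Rightarrow> 'a set" where
  "minimizers h = {x. \<forall>y. h x \<le> h y}"

text \<open>For \<open>h \<in> Gamma0\<close> in a Hilbert space the set of minimizers below is a singleton.\<close>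

definition s_Prox :: "('a::real_inner \<Rightarrow> ereal) \<Rightarrow> 'a \<Rightarrow> 'a" where
  "s_Prox h x = (THE y. y \<in> minimizers (\<lambda>y. h y + ereal (1 / 2 * (norm (x - y))\<^sup>2)))"

definition converges_weakly :: "(nat \<Rightarrow> 'a::real_inner) \<Rightarrow> 'a \<Rightarrow> bool" where
  "converges_weakly x l \<longleftrightarrow> (\<forall>y. (\<lambda>k. x k \<bullet> y) \<longlonglongrightarrow> l \<bullet> y)"

end

theory Submission
  imports Defs
begin

text \<open>
  The penalty \<open>\<phi>\<close> need not be convex: the conjugate of \<open>\<psi>\<close> is \<open>\<beta>\<close>-strongly convex, while
  \<open>\<phi>\<close> subtracts a quadratic of curvature \<open>1 > \<beta>\<close>. But \<open>\<mu> f\<close> has strong convexity to spare, and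
  moving \<open>(1 - \<beta>) / 2 * \<parallel>x\<parallel>\<^sup>2\<close> from \<open>\<mu> f\<close> to \<open>\<phi>\<close> leaves the sum unchanged and makes both parts
  convex. The iteration turns out to be the forward-backward method for this convex splitting, with
  step size \<open>1 / \<beta>\<close>. The lower bound on \<open>\<mu>\<close> makes the shifted \<open>f\<close> convex; the upper bound makes
  the step size smaller than \<open>2 / L\<close>.

  Everything about \<open>\<psi>\<close> and the shifted \<open>f\<close> follows from two inequalities, collected in the locale
  \<open>quadratic_sandwich\<close>: each function lies above its tangents and below its tangent paraboloids.
  The upper paraboloids give a Fenchel--Young inequality with quadratic gain
  (\<open>conjugate_lower_bound\<close>). It shows that the convexified penalty is a supremum of affine
  functions, so that it belongs to \<open>Gamma0\<close>; that \<open>T\<close> is its proximity operator after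
  rescaling; and that gradients are cocoercive.

  For convergence, \<open>minimizer_iff_fixed_point\<close> identifies minimizers with fixed points of the step,
  and \<open>step_averaged\<close> shows that the step is averaged. Weak convergence of iterates of averaged maps
  is proved through asymptotic centers, the minimizers of the limit superior of \<open>\<parallel>x k - y\<parallel>\<^sup>2\<close> as a
  function of \<open>y\<close>, instead of weak compactness. They exist by the same minimization lemma that
  yields the Riesz representation, which in turn supplies the gradients.
\<close>

section \<open>Minimization and the Riesz representation\<close>

text \<open>
  The midpoint of two nearly minimal points cannot undercut the infimum, so the midpoint inequality
  forces the two points to be close: minimizing sequences are Cauchy. The same inequality at the
  minimizer gives quadratic growth around it. The lemma is applied twice: to obtain the
  representing vector of a functional, and to obtain asymptotic centers.
\<close>

lemma strongly_midconvex_attains_min: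
  fixes r :: "'a::{real_inner, complete_space} \<Rightarrow> real"
  assumes below: "\<And>x. m \<le> r x"
    and mid: "\<And>y z. r ((1 / 2) *\<^sub>R (y + z)) \<le> (r y + r z) / 2 - (norm (y - z))\<^sup>2 / 4"
    and lsc: "\<And>u a l. u \<longlonglongrightarrow> a \<Longrightarrow> (\<lambda>n. r (u n)) \<longlonglongrightarrow> l \<Longrightarrow> r a \<le> l"
  obtains a where "\<And>y. r a + (norm (y - a))\<^sup>2 / 2 \<le> r y"
proof -
  define i where "i = Inf (range r)"
  have i_le: "i \<le> r x" for x
    unfolding i_def by (rule cInf_lower) (use below in \<open>auto intro!: bdd_belowI\<close>)
  have "\<exists>x. r x < i + 1 / real (Suc n)" for n
  proof -
    have "Inf (range r) < i + 1 / real (Suc n)" by (simp add: i_def)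
    from cInf_lessD[OF _ this] show ?thesis by auto
  qed
  then obtain u where u: "r (u n) < i + 1 / real (Suc n)" for n by metis
  have dist_u: "(norm (u k - u n))\<^sup>2 \<le> 2 / real (Suc k) + 2 / real (Suc n)" for k n
  proof -
    have "i \<le> (r (u k) + r (u n)) / 2 - (norm (u k - u n))\<^sup>2 / 4"
      using mid[of "u k" "u n"] i_le[of "(1 / 2) *\<^sub>R (u k + u n)"] by (rule order_trans[rotated])
    moreover obtain p q where pq: "p = 1 / real (Suc k)" "q = 1 / real (Suc n)" by blast
    moreover have "r (u k) < i + p" "r (u n) < i + q" unfolding pq by (rule u)+
    ultimately have "(norm (u k - u n))\<^sup>2 \<le> 2 * p + 2 * q" by argo
    then show ?thesis by (simp add: pq)
  qed
  have "Cauchy u"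
  proof (rule CauchyI)
    fix e :: real assume "e > 0"
    then have "e\<^sup>2 / 4 > 0" by simp
    then obtain N where N: "1 / real (Suc N) < e\<^sup>2 / 4" by (metis nat_approx_posE)
    have "norm (u k - u n) < e" if "k \<ge> N" "n \<ge> N" for k n
    proof -
      have "1 / real (Suc k) \<le> 1 / real (Suc N)" "1 / real (Suc n) \<le> 1 / real (Suc N)"
        using that by (auto intro!: divide_left_mono)
      then have "(norm (u k - u n))\<^sup>2 < e\<^sup>2" using dist_u[of k n] N by simp
      then show ?thesis using \<open>e > 0\<close> by (simp add: power2_less_imp_less)
    qed
    then show "\<exists>N. \<forall>k\<ge>N. \<forall>n\<ge>N. norm (u k - u n) < e" by blast
  qed
  then obtain a where a: "u \<longlonglongrightarrow> a" by (auto simp: Cauchy_convergent_iff convergent_def)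
  have lim: "(\<lambda>n. i + 1 / real (Suc n)) \<longlonglongrightarrow> i"
    using LIMSEQ_inverse_real_of_nat_add[of i] by (simp add: inverse_eq_divide)
  have "(\<lambda>n. r (u n)) \<longlonglongrightarrow> i"
    by (rule tendsto_sandwich[OF _ _ tendsto_const lim])
      (use i_le u in \<open>auto intro!: always_eventually less_imp_le\<close>)
  then have "r a \<le> i" by (rule lsc[OF a])
  then have "r a + (norm (y - a))\<^sup>2 / 2 \<le> r y" for y
    using mid[of y a] i_le[of "(1 / 2) *\<^sub>R (y + a)"] by argo
  then show ?thesis by (rule that)
qed

text \<open>
  The parallelogram law, in the form that makes a squared norm satisfy the midpoint inequality.
\<close>

lemma norm_midpoint_sq:
  fixes y z :: "'a::real_inner"
  shows "(norm ((1 / 2) *\<^sub>R (y + z)))\<^sup>2 = ((norm y)\<^sup>2 + (norm z)\<^sup>2) / 2 - (norm (y - z))\<^sup>2 / 4"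
  by (simp add: power_mult_distrib power2_norm_eq_inner inner_simps inner_commute field_simps)

text \<open>
  The representing vector of \<open>\<phi>\<close> is the minimizer of \<open>\<parallel>x\<parallel>\<^sup>2 - 2 \<phi> x\<close>: there the derivative
  \<open>2 (v \<bullet> a - \<phi> v)\<close> in every direction \<open>v\<close> vanishes.
\<close>

theorem riesz_representation:
  fixes \<phi> :: "'a::{real_inner, complete_space} \<Rightarrow> real"
  assumes "bounded_linear \<phi>"
  obtains a where "\<And>v. \<phi> v = v \<bullet> a"
proof -
  interpret bounded_linear \<phi> by fact
  obtain K where K: "\<bar>\<phi> x\<bar> \<le> norm x * K" for x using bounded by auto
  define J where "J x = (norm x)\<^sup>2 - 2 * \<phi> x" for x
  have below: "- K\<^sup>2 \<le> J x" for x
    using K[of x] zero_le_power2[of "norm x - K"] by (simp add: J_def power2_diff abs_le_iff)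
  have mid: "J ((1 / 2) *\<^sub>R (y + z)) \<le> (J y + J z) / 2 - (norm (y - z))\<^sup>2 / 4" for y z
    unfolding J_def norm_midpoint_sq scale add by (simp add: field_simps)
  have lsc: "J a \<le> l" if "u \<longlonglongrightarrow> a" "(\<lambda>n. J (u n)) \<longlonglongrightarrow> l" for u a l
  proof -
    have "(\<lambda>n. J (u n)) \<longlonglongrightarrow> J a"
      unfolding J_def by (intro tendsto_intros tendsto that(1))
    then show ?thesis using LIMSEQ_unique that(2) by blast
  qed
  obtain a where a: "J a + (norm (y - a))\<^sup>2 / 2 \<le> J y" for y
    by (rule strongly_midconvex_attains_min[of "- K\<^sup>2" J]) (use below mid lsc in blast)+
  have "\<phi> v = v \<bullet> a" for v
  proof -
    define q s where "q = v \<bullet> a - \<phi> v" and "s = 1 / ((norm v)\<^sup>2 + 1)"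
    have s: "0 < s" "s * (norm v)\<^sup>2 \<le> 1" by (auto simp: s_def add_nonneg_pos divide_simps)
    have "0 \<le> 2 * t * q + t\<^sup>2 * (norm v)\<^sup>2 / 2" for t
    proof -
      have "J (a + t *\<^sub>R v) = J a + 2 * t * q + t\<^sup>2 * (norm v)\<^sup>2"
        unfolding J_def q_def add scale power2_norm_eq_inner
        by (simp add: inner_simps inner_commute power2_eq_square algebra_simps)
      moreover have "(norm (a + t *\<^sub>R v - a))\<^sup>2 = t\<^sup>2 * (norm v)\<^sup>2"
        by (simp add: power_mult_distrib)
      ultimately show ?thesis using a[of "a + t *\<^sub>R v"] by linarith
    qed
    from this[of "- (s * q)"] have "0 \<le> (s * q\<^sup>2) * (s * (norm v)\<^sup>2 / 2 - 2)"
      by (simp add: power2_eq_square algebra_simps)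
    moreover have "s * (norm v)\<^sup>2 / 2 - 2 < 0" using s(2) by simp
    ultimately have "s * q\<^sup>2 \<le> 0" by (simp add: zero_le_mult_iff)
    then have "q = 0" using s(1) by (simp add: mult_le_0_iff)
    then show ?thesis by (simp add: q_def)
  qed
  then show ?thesis by (rule that)
qed

section \<open>Gradients in Hilbert space\<close>

lemma GDERIV_unique:
  assumes "GDERIV f x :> D" "GDERIV f x :> E"
  shows "D = E"
proof -
  have "(\<lambda>h. h \<bullet> D) = (\<lambda>h. h \<bullet> E)"
    using assms unfolding gderiv_def by (rule has_derivative_unique)
  then show ?thesis by (metis inner_commute vector_eq_ldot)
qed

lemma gradient_eqI: "GDERIV f x :> D \<Longrightarrow> gradient f x = D"
  unfolding gradient_def by (blast intro: GDERIV_unique)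

text \<open>
  Completeness is what turns Frechet differentiability into the existence of a gradient: the
  derivative is a bounded functional, and its representing vector is the gradient.
\<close>

lemma GDERIV_gradient:
  fixes f :: "'a::{real_inner, complete_space} \<Rightarrow> real"
  assumes "f differentiable (at x)"
  shows "GDERIV f x :> gradient f x"
proof -
  obtain f' where f': "(f has_derivative f') (at x)"
    using assms by (auto simp: differentiable_def)
  obtain a where "\<And>v. f' v = v \<bullet> a"
    using riesz_representation[OF has_derivative_bounded_linear[OF f']] by blast
  then have "f' = (\<lambda>v. v \<bullet> a)" by (rule ext)
  then have "GDERIV f x :> a" using f' by (simp add: gderiv_def)
  then show ?thesis using gradient_eqI by metis
qed

section \<open>Asymptotic centers and weak convergence\<close>

text \<open>
  This is the limit superior of \<open>\<parallel>X n - y\<parallel>\<^sup>2\<close>, written as an infimum of eventual upper bounds so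
  that it is a real number; for unbounded \<open>X\<close> its value is meaningless.
\<close>

definition asymptotic_radius_sq :: "(nat \<Rightarrow> 'a::real_inner) \<Rightarrow> 'a \<Rightarrow> real" where
  "asymptotic_radius_sq X y = Inf {c. \<forall>\<^sub>F n in sequentially. (norm (X n - y))\<^sup>2 \<le> c}"

lemma asymptotic_radius_sq_le:
  assumes "\<forall>\<^sub>F n in sequentially. (norm (X n - y))\<^sup>2 \<le> c"
  shows "asymptotic_radius_sq X y \<le> c"
  unfolding asymptotic_radius_sq_def
proof (rule cInf_lower)
  have "0 \<le> d" if "\<forall>\<^sub>F n in sequentially. (norm (X n - y))\<^sup>2 \<le> d" for d
    using eventually_happens[OF that] by (auto intro: order_trans[OF zero_le_power2])
  then show "bdd_below {c. \<forall>\<^sub>F n in sequentially. (norm (X n - y))\<^sup>2 \<le> c}"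
    by (auto intro!: bdd_belowI)
qed (use assms in simp)

lemma asymptotic_radius_sq_less:
  assumes "Bseq X" "asymptotic_radius_sq X y < c"
  shows "\<forall>\<^sub>F n in sequentially. (norm (X n - y))\<^sup>2 \<le> c"
proof -
  obtain B where B: "norm (X n) \<le> B" for n using assms(1) by (auto simp: Bseq_def)
  have "(norm (X n - y))\<^sup>2 \<le> (B + norm y)\<^sup>2" for n
    using norm_triangle_ineq4[of "X n" y] B[of n] by (intro power_mono) auto
  then have "(B + norm y)\<^sup>2 \<in> {c. \<forall>\<^sub>F n in sequentially. (norm (X n - y))\<^sup>2 \<le> c}" by simp
  then obtain d where "d < c" "\<forall>\<^sub>F n in sequentially. (norm (X n - y))\<^sup>2 \<le> d"
    using cInf_lessD[OF _ assms(2)[unfolded asymptotic_radius_sq_def]] by blast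
  then show ?thesis by (auto elim!: eventually_mono)
qed

lemma asymptotic_radius_sq_nonneg:
  assumes "Bseq X"
  shows "0 \<le> asymptotic_radius_sq X y"
proof (rule field_le_epsilon)
  fix e :: real assume "e > 0"
  then have "\<forall>\<^sub>F n in sequentially. (norm (X n - y))\<^sup>2 \<le> asymptotic_radius_sq X y + e"
    by (intro asymptotic_radius_sq_less assms) simp
  then show "0 \<le> asymptotic_radius_sq X y + e"
    using eventually_happens[of _ sequentially] by (force intro: order_trans[OF zero_le_power2])
qed

lemma asymptotic_radius_sq_limit:
  assumes "Bseq X" "(\<lambda>n. (norm (X n - y))\<^sup>2) \<longlonglongrightarrow> l"
  shows "asymptotic_radius_sq X y = l"
proof (rule antisym; rule field_le_epsilon)
  fix e :: real assume "e > 0"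
  show "asymptotic_radius_sq X y \<le> l + e"
    by (rule asymptotic_radius_sq_le)
      (use order_tendstoD(2)[OF assms(2), of "l + e"] \<open>e > 0\<close> in \<open>auto elim!: eventually_mono\<close>)
  have "\<forall>\<^sub>F n in sequentially. (norm (X n - y))\<^sup>2 \<le> asymptotic_radius_sq X y + e"
    using \<open>e > 0\<close> by (intro asymptotic_radius_sq_less assms) simp
  then show "l \<le> asymptotic_radius_sq X y + e"
    using tendsto_upperbound[OF assms(2)] by simp
qed

lemma asymptotic_radius_sq_perturb:
  assumes "Bseq X" "\<forall>\<^sub>F n in sequentially. (norm (X n - z))\<^sup>2 \<le> (norm (X n - y))\<^sup>2 + d"
  shows "asymptotic_radius_sq X z \<le> asymptotic_radius_sq X y + d"
proof (rule field_le_epsilon)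
  fix e :: real assume "e > 0"
  then have "\<forall>\<^sub>F n in sequentially. (norm (X n - y))\<^sup>2 \<le> asymptotic_radius_sq X y + e"
    by (intro asymptotic_radius_sq_less assms) simp
  with assms(2) have "\<forall>\<^sub>F n in sequentially. (norm (X n - z))\<^sup>2 \<le> asymptotic_radius_sq X y + d + e"
    by eventually_elim simp
  then show "asymptotic_radius_sq X z \<le> asymptotic_radius_sq X y + d + e"
    by (rule asymptotic_radius_sq_le)
qed

text \<open>
  A limit superior of squared distances inherits the parallelogram inequality and is locally
  Lipschitz in \<open>y\<close>, hence has a unique minimizer, the asymptotic center of \<open>X\<close>.
\<close>

lemma asymptotic_center_exists:
  fixes X :: "nat \<Rightarrow> 'a::{real_inner, complete_space}"
  assumes "Bseq X"
  obtains a where "\<And>y. asymptotic_radius_sq X a + (norm (y - a))\<^sup>2 / 2 \<le> asymptotic_radius_sq X y"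
proof (rule strongly_midconvex_attains_min)
  show "0 \<le> asymptotic_radius_sq X y" for y
    by (rule asymptotic_radius_sq_nonneg[OF assms])
  let ?r = "asymptotic_radius_sq X"
  fix y z
  show "?r ((1 / 2) *\<^sub>R (y + z)) \<le> (?r y + ?r z) / 2 - (norm (y - z))\<^sup>2 / 4"
  proof (rule field_le_epsilon)
    fix e :: real assume "e > 0"
    then have y: "\<forall>\<^sub>F n in sequentially. (norm (X n - y))\<^sup>2 \<le> ?r y + e"
      and z: "\<forall>\<^sub>F n in sequentially. (norm (X n - z))\<^sup>2 \<le> ?r z + e"
      by (auto intro!: asymptotic_radius_sq_less assms)
    have mid: "(norm (X n - (1 / 2) *\<^sub>R (y + z)))\<^sup>2
        = ((norm (X n - y))\<^sup>2 + (norm (X n - z))\<^sup>2) / 2 - (norm (y - z))\<^sup>2 / 4" for n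
      using norm_midpoint_sq[of "X n - y" "X n - z"]
      by (simp add: algebra_simps norm_minus_commute flip: scaleR_add_left)
    show "?r ((1 / 2) *\<^sub>R (y + z)) \<le> (?r y + ?r z) / 2 - (norm (y - z))\<^sup>2 / 4 + e"
    proof (rule asymptotic_radius_sq_le)
      show "\<forall>\<^sub>F n in sequentially. (norm (X n - (1 / 2) *\<^sub>R (y + z)))\<^sup>2
          \<le> (?r y + ?r z) / 2 - (norm (y - z))\<^sup>2 / 4 + e"
        using y z unfolding mid by eventually_elim (simp add: field_simps)
    qed
  qed
next
  let ?r = "asymptotic_radius_sq X"
  fix u a l assume u: "u \<longlonglongrightarrow> a" and l: "(\<lambda>n. ?r (u n)) \<longlonglongrightarrow> l"
  obtain B where B: "norm (X n) \<le> B" for n using assms by (auto simp: Bseq_def)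
  define M where "M = B + norm a"
  have M: "norm (X n - a) \<le> M" for n
    using norm_triangle_ineq4[of "X n" a] B[of n] by (simp add: M_def)
  have le: "?r a \<le> ?r y + 2 * M * norm (y - a)" for y
  proof (rule asymptotic_radius_sq_perturb[OF assms always_eventually], intro allI)
    fix n
    have "(X n - a) \<bullet> (y - a) \<le> norm (X n - a) * norm (y - a)" by (rule norm_cauchy_schwarz)
    also have "\<dots> \<le> M * norm (y - a)" by (intro mult_right_mono M) simp
    finally have "2 * ((X n - a) \<bullet> (y - a)) - (norm (y - a))\<^sup>2 \<le> 2 * M * norm (y - a)"
      using zero_le_power2[of "norm (y - a)"] by linarith
    moreover have "(norm (X n - a))\<^sup>2
        = (norm (X n - y))\<^sup>2 + (2 * ((X n - a) \<bullet> (y - a)) - (norm (y - a))\<^sup>2)"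
      by (simp add: power2_norm_eq_inner inner_simps inner_commute)
    ultimately show "(norm (X n - a))\<^sup>2 \<le> (norm (X n - y))\<^sup>2 + 2 * M * norm (y - a)" by simp
  qed
  have "(\<lambda>n. norm (u n - a)) \<longlonglongrightarrow> 0"
    using u by (simp add: LIM_zero tendsto_norm_zero)
  then have "(\<lambda>n. ?r (u n) + 2 * M * norm (u n - a)) \<longlonglongrightarrow> l + 2 * M * 0"
    by (intro tendsto_intros l)
  then show "?r a \<le> l" using le by (intro LIMSEQ_le_const) auto
qed (use that in blast)

text \<open>
  If \<open>(X n - a) \<bullet> y\<close> stayed above some \<open>e > 0\<close> along a subsequence, then moving from \<open>a\<close> a little
  in the direction \<open>y\<close> would bring every term of that subsequence closer by a fixed amount, and
  \<open>a\<close> would not be its center.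
\<close>

lemma weakly_convergent_if_common_center:
  fixes X :: "nat \<Rightarrow> 'a::{real_inner, complete_space}"
  assumes bounded: "Bseq X"
    and l: "(\<lambda>n. (norm (X n - a))\<^sup>2) \<longlonglongrightarrow> l"
    and center: "\<And>s y. strict_mono s \<Longrightarrow>
      asymptotic_radius_sq (X \<circ> s) a \<le> asymptotic_radius_sq (X \<circ> s) y"
  shows "converges_weakly X a"
proof -
  have ub: "\<forall>\<^sub>F n in sequentially. (X n - a) \<bullet> y \<le> e" if "e > 0" for y e
  proof (rule ccontr)
    assume "\<not> ?thesis"
    then obtain s :: "nat \<Rightarrow> nat" where s: "strict_mono s" "\<And>n. \<not> (X (s n) - a) \<bullet> y \<le> e"
      using not_eventually_sequentiallyD by blast
    have bdd: "Bseq (X \<circ> s)" using bounded by (simp add: Bseq_subseq comp_def)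
    \<comment> \<open>The step must satisfy \<open>t \<parallel>y\<parallel>\<^sup>2 < 2 e\<close>, so that the gain \<open>2 t e\<close> beats the loss \<open>t\<^sup>2 \<parallel>y\<parallel>\<^sup>2\<close>.\<close>
    define t where "t = e / ((norm y)\<^sup>2 + 1)"
    have t: "t > 0" "t * (norm y)\<^sup>2 < 2 * e"
    proof -
      have "t * ((norm y)\<^sup>2 + 1) = e"
        unfolding t_def using add_nonneg_pos[OF zero_le_power2[of "norm y"], of 1] by simp
      moreover show "t > 0" unfolding t_def using \<open>e > 0\<close> by (simp add: add_nonneg_pos)
      ultimately show "t * (norm y)\<^sup>2 < 2 * e" using \<open>e > 0\<close> by (simp add: algebra_simps)
    qed
    have "asymptotic_radius_sq (X \<circ> s) (a + t *\<^sub>R y)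
        \<le> asymptotic_radius_sq (X \<circ> s) a + t * (t * (norm y)\<^sup>2 - 2 * e)"
    proof (rule asymptotic_radius_sq_perturb[OF bdd always_eventually], intro allI)
      fix n
      have "(norm ((X \<circ> s) n - (a + t *\<^sub>R y)))\<^sup>2
          = (norm ((X \<circ> s) n - a))\<^sup>2 + t * (t * (norm y)\<^sup>2 - 2 * ((X (s n) - a) \<bullet> y))"
        by (simp add: power2_norm_eq_inner inner_simps inner_commute algebra_simps)
      moreover have "t * (t * (norm y)\<^sup>2 - 2 * ((X (s n) - a) \<bullet> y)) \<le> t * (t * (norm y)\<^sup>2 - 2 * e)"
        using s(2)[of n] t(1) by (intro mult_left_mono) auto
      ultimately show "(norm ((X \<circ> s) n - (a + t *\<^sub>R y)))\<^sup>2
          \<le> (norm ((X \<circ> s) n - a))\<^sup>2 + t * (t * (norm y)\<^sup>2 - 2 * e)" by simp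
    qed
    moreover have "t * (t * (norm y)\<^sup>2 - 2 * e) < 0" using t by (simp add: mult_pos_neg)
    ultimately show False using center[OF s(1), of "a + t *\<^sub>R y"] by simp
  qed
  show ?thesis
    unfolding converges_weakly_def
  proof (intro allI LIMSEQ_I)
    fix y and e :: real assume "e > 0"
    then have "e / 2 > 0" by simp
    from ub[OF this, of y] ub[OF this, of "- y"]
    have "\<forall>\<^sub>F n in sequentially. norm (X n \<bullet> y - a \<bullet> y) < e"
      by eventually_elim (use \<open>e > 0\<close> in \<open>auto simp: inner_simps abs_less_iff\<close>)
    then show "\<exists>N. \<forall>n\<ge>N. norm (X n \<bullet> y - a \<bullet> y) < e" by (simp add: eventually_sequentially)
  qed
qed

section \<open>Iteration of averaged maps\<close>

text \<open>
  Distances to fixed points decrease along the iteration, and the averagedness term makes the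
  displacements \<open>x k - S (x k)\<close> vanish. Therefore \<open>S\<close> does not increase the asymptotic radius of
  any subsequence, so each asymptotic center is a fixed point. For fixed points the radius is a
  genuine limit, the same for all subsequences, hence all subsequences share one center, and this
  center is the weak limit.
\<close>

theorem averaged_iteration_converges_weakly:
  fixes S :: "'a::{real_inner, complete_space} \<Rightarrow> 'a"
  assumes "\<alpha> > 0"
    and averaged: "\<And>y z. (norm (S y - S z))\<^sup>2
      \<le> (norm (y - z))\<^sup>2 - \<alpha> * (norm ((y - S y) - (z - S z)))\<^sup>2"
    and fixpoint: "S q = q"
    and iterate: "\<And>k. x (Suc k) = S (x k)"
  obtains p where "S p = p" "converges_weakly x p"
proof -
  have nonexp: "norm (S y - S z) \<le> norm (y - z)" for y z
  proof (rule power2_le_imp_le)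
    have "0 \<le> \<alpha> * (norm ((y - S y) - (z - S z)))\<^sup>2" using \<open>\<alpha> > 0\<close> by simp
    then show "(norm (S y - S z))\<^sup>2 \<le> (norm (y - z))\<^sup>2" using averaged[of y z] by linarith
  qed simp
  have fejer: "(norm (x (Suc k) - p))\<^sup>2 \<le> (norm (x k - p))\<^sup>2 - \<alpha> * (norm (x k - x (Suc k)))\<^sup>2"
    if "S p = p" for p k
    using averaged[of "x k" p] that by (simp add: iterate)
  have "\<exists>l. (\<lambda>k. (norm (x k - p))\<^sup>2) \<longlonglongrightarrow> l" if "S p = p" for p
  proof -
    have "decseq (\<lambda>k. (norm (x k - p))\<^sup>2)"
      using nonexp[of _ p] that by (intro decseq_SucI power_mono) (auto simp: iterate)
    then show ?thesis by (rule decseq_convergent[where B = 0]) auto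
  qed
  then obtain l where l: "(\<lambda>k. (norm (x k - p))\<^sup>2) \<longlonglongrightarrow> l p" if "S p = p" for p by metis
  have bounded: "Bseq x"
  proof -
    have "norm (x k - q) \<le> norm (x 0 - q)" for k
      by (induction k) (use nonexp[of _ q] fixpoint in \<open>auto simp: iterate intro: order_trans\<close>)
    then have "norm (x k) \<le> norm (x 0 - q) + norm q" for k
      using norm_triangle_ineq[of "x k - q" q] by (smt (verit) diff_add_cancel)
    then show ?thesis by (rule BseqI')
  qed
  have regular: "(\<lambda>k. norm (x k - S (x k))) \<longlonglongrightarrow> 0"
  proof -
    let ?d = "\<lambda>k. ((norm (x k - q))\<^sup>2 - (norm (x (Suc k) - q))\<^sup>2) / \<alpha>"
    have "(\<lambda>k. (norm (x (Suc k) - q))\<^sup>2) \<longlonglongrightarrow> l q"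
      using l[OF fixpoint] by (rule LIMSEQ_Suc)
    then have "?d \<longlonglongrightarrow> (l q - l q) / \<alpha>"
      by (intro tendsto_intros l[OF fixpoint]) (use \<open>\<alpha> > 0\<close> in auto)
    then have d: "?d \<longlonglongrightarrow> 0" by simp
    have "(norm (x k - S (x k)))\<^sup>2 \<le> ?d k" for k
      using fejer[OF fixpoint, of k] \<open>\<alpha> > 0\<close> by (simp add: iterate field_simps)
    then have "(\<lambda>k. (norm (x k - S (x k)))\<^sup>2) \<longlonglongrightarrow> 0"
      by (intro tendsto_sandwich[OF _ _ tendsto_const d]) auto
    from tendsto_real_sqrt[OF this] show ?thesis by simp
  qed
  have center_fixed: "S a = a"
    if s: "strict_mono s"
      and a: "\<And>y. asymptotic_radius_sq (x \<circ> s) a + (norm (y - a))\<^sup>2 / 2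
        \<le> asymptotic_radius_sq (x \<circ> s) y" for s a
  proof -
    have bdd: "Bseq (x \<circ> s)" using bounded by (simp add: Bseq_subseq comp_def)
    obtain B where B: "norm (x n) \<le> B" for n using bounded by (auto simp: Bseq_def)
    have "asymptotic_radius_sq (x \<circ> s) (S a) \<le> asymptotic_radius_sq (x \<circ> s) a"
    proof (rule field_le_epsilon)
      fix e :: real assume "e > 0"
      let ?d = "\<lambda>n. norm (x (s n) - S (x (s n)))"
      have d0: "?d \<longlonglongrightarrow> 0"
        using LIMSEQ_subseq_LIMSEQ[OF regular s] by (simp add: comp_def)
      have "(\<lambda>n. 2 * (B + norm a) * ?d n + (?d n)\<^sup>2) \<longlonglongrightarrow> 2 * (B + norm a) * 0 + 0\<^sup>2"
        by (intro tendsto_intros d0)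
      then have small: "\<forall>\<^sub>F n in sequentially. 2 * (B + norm a) * ?d n + (?d n)\<^sup>2 < e"
        using \<open>e > 0\<close> by (simp add: order_tendsto_iff)
      show "asymptotic_radius_sq (x \<circ> s) (S a) \<le> asymptotic_radius_sq (x \<circ> s) a + e"
      proof (rule asymptotic_radius_sq_perturb[OF bdd])
        show "\<forall>\<^sub>F n in sequentially. (norm ((x \<circ> s) n - S a))\<^sup>2 \<le> (norm ((x \<circ> s) n - a))\<^sup>2 + e"
          using small
        proof eventually_elim
          case (elim n)
          have "norm (x (s n) - S a) \<le> ?d n + norm (S (x (s n)) - S a)"
            using norm_triangle_ineq[of "x (s n) - S (x (s n))" "S (x (s n)) - S a"] by simp
          also have "\<dots> \<le> norm (x (s n) - a) + ?d n" using nonexp[of "x (s n)" a] by simp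
          finally have "(norm (x (s n) - S a))\<^sup>2 \<le> (norm (x (s n) - a) + ?d n)\<^sup>2"
            by (intro power_mono) auto
          moreover have "norm (x (s n) - a) * ?d n \<le> (B + norm a) * ?d n"
            using norm_triangle_ineq4[of "x (s n)" a] B[of "s n"] by (intro mult_right_mono) auto
          ultimately show ?case using elim by (simp add: power2_sum algebra_simps)
        qed
      qed
    qed
    then have "(norm (S a - a))\<^sup>2 \<le> 0" using a[of "S a"] by linarith
    then show ?thesis by simp
  qed
  have id: "strict_mono (id :: nat \<Rightarrow> nat)" by (simp add: strict_mono_def)
  obtain a where a: "asymptotic_radius_sq x a + (norm (y - a))\<^sup>2 / 2 \<le> asymptotic_radius_sq x y" for y
    using asymptotic_center_exists[OF bounded] by blast
  have "S a = a" by (rule center_fixed[OF id]) (use a in simp)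
  moreover have "converges_weakly x a"
  proof (rule weakly_convergent_if_common_center[OF bounded l])
    fix s :: "nat \<Rightarrow> nat" and y assume s: "strict_mono s"
    have bdd: "Bseq (x \<circ> s)" using bounded by (simp add: Bseq_subseq comp_def)
    have radius: "asymptotic_radius_sq (x \<circ> s) p = l p" "asymptotic_radius_sq x p = l p" if "S p = p" for p
      using asymptotic_radius_sq_limit[OF bounded l[OF that]]
        asymptotic_radius_sq_limit[OF bdd, of p "l p"] LIMSEQ_subseq_LIMSEQ[OF l[OF that] s]
      by (simp_all add: comp_def)
    obtain b where b: "asymptotic_radius_sq (x \<circ> s) b + (norm (y - b))\<^sup>2 / 2
        \<le> asymptotic_radius_sq (x \<circ> s) y" for y
      using asymptotic_center_exists[OF bdd] by blast
    have "S b = b" using s b by (rule center_fixed)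
    \<comment> \<open>Both centers are fixed, so each radius equals the common limit \<open>l\<close>; adding the two growth
      inequalities leaves only the squared distance.\<close>
    have "(norm (a - b))\<^sup>2 \<le> 0"
      using a[of b] b[of a] radius[OF \<open>S a = a\<close>] radius[OF \<open>S b = b\<close>]
      unfolding norm_minus_commute[of b a] by linarith
    then have "a = b" by simp
    then show "asymptotic_radius_sq (x \<circ> s) a \<le> asymptotic_radius_sq (x \<circ> s) y"
      unfolding \<open>a = b\<close> using b[of y] zero_le_power2[of "norm (y - b)"] by linarith
  qed (rule \<open>S a = a\<close>)
  ultimately show ?thesis by (rule that)
qed

section \<open>Tangents of convex functions with Lipschitz gradient\<close>

lemma GDERIV_along_line:
  assumes "GDERIV h (x + t *\<^sub>R d) :> D"
  shows "((\<lambda>t. h (x + t *\<^sub>R d)) has_real_derivative D \<bullet> d) (at t)"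
proof -
  have "((\<lambda>t. x + t *\<^sub>R d) has_derivative (\<lambda>s. s *\<^sub>R d)) (at t)"
    by (auto intro!: derivative_eq_intros)
  from has_derivative_compose[OF this assms[unfolded gderiv_def]]
  have "((\<lambda>t. h (x + t *\<^sub>R d)) has_derivative (\<lambda>s. s * (D \<bullet> d))) (at t)"
    by (simp add: inner_commute)
  then show ?thesis unfolding mult.commute[of _ "D \<bullet> d"] by (rule has_derivative_imp_has_field_derivative) simp
qed

lemma convex_above_tangent:
  fixes h :: "'a::real_inner \<Rightarrow> real"
  assumes "convex_on UNIV h" "GDERIV h x :> D"
  shows "h x + D \<bullet> (y - x) \<le> h y"
proof -
  let ?p = "\<lambda>t. h (x + t *\<^sub>R (y - x))"
  have "convex_on UNIV ?p"
  proof (rule convex_onI)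
    fix t r s :: real assume t: "0 < t" "t < 1"
    have "x + ((1 - t) *\<^sub>R r + t *\<^sub>R s) *\<^sub>R (y - x)
        = (1 - t) *\<^sub>R (x + r *\<^sub>R (y - x)) + t *\<^sub>R (x + s *\<^sub>R (y - x))"
      by (simp add: algebra_simps)
    then show "?p ((1 - t) *\<^sub>R r + t *\<^sub>R s) \<le> (1 - t) * ?p r + t * ?p s"
      using convex_onD[OF assms(1), of t] t by simp
  qed simp
  moreover have "(?p has_real_derivative D \<bullet> (y - x)) (at 0)"
    by (rule GDERIV_along_line) (use assms(2) in simp)
  ultimately have "?p 1 - ?p 0 \<ge> (D \<bullet> (y - x)) * (1 - 0)"
    by (intro convex_on_imp_above_tangent[where A = UNIV]) auto
  then show ?thesis by simp
qed

text \<open>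
  Along the segment from \<open>x\<close> to \<open>y\<close>, the Lipschitz bound makes \<open>h\<close> minus the claimed upper bound
  a nonincreasing function of the parameter.
\<close>

lemma descent_lemma:
  fixes h :: "'a::real_inner \<Rightarrow> real"
  assumes grad: "\<And>x. GDERIV h x :> g x" and lip: "K-lipschitz_on UNIV g"
  shows "h y \<le> h x + g x \<bullet> (y - x) + K / 2 * (norm (y - x))\<^sup>2"
proof -
  define d where "d = y - x"
  let ?p = "\<lambda>t. h (x + t *\<^sub>R d) - t * (g x \<bullet> d) - t\<^sup>2 * (K / 2 * (norm d)\<^sup>2)"
  have "?p 1 \<le> ?p 0"
  proof (rule DERIV_nonpos_imp_nonincreasing[where f = ?p])
    fix t :: real assume t: "0 \<le> t"
    have "(g (x + t *\<^sub>R d) - g x) \<bullet> d \<le> norm (g (x + t *\<^sub>R d) - g x) * norm d"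
      by (rule norm_cauchy_schwarz)
    also have "\<dots> \<le> (K * norm (t *\<^sub>R d)) * norm d"
      using lipschitz_onD[OF lip, of "x + t *\<^sub>R d" x] by (intro mult_right_mono) (auto simp: dist_norm)
    finally have "(g (x + t *\<^sub>R d) - g x) \<bullet> d \<le> t * K * (norm d)\<^sup>2"
      using t by (simp add: power2_eq_square mult_ac)
    moreover have "(?p has_real_derivative
        g (x + t *\<^sub>R d) \<bullet> d - g x \<bullet> d - 2 * t * (K / 2 * (norm d)\<^sup>2)) (at t)"
      by (rule derivative_eq_intros GDERIV_along_line grad refl | simp)+
    ultimately show "\<exists>D. DERIV ?p t :> D \<and> D \<le> 0" by (auto simp: inner_diff_left)
  qed simp
  then show ?thesis by (simp add: d_def)
qed

section \<open>Conjugates of smooth convex functions\<close>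

text \<open>
  A convex function with \<open>K\<close>-Lipschitz gradient \<open>g\<close> lies between its tangents and its tangent
  paraboloids of curvature \<open>K\<close>. These two inequalities stand in for differentiability in what follows.
\<close>

locale quadratic_sandwich =
  fixes h :: "'a::real_inner \<Rightarrow> real" and g :: "'a \<Rightarrow> 'a" and K :: real
  assumes K_pos: "K > 0"
    and lower: "\<And>x y. h x + g x \<bullet> (y - x) \<le> h y"
    and upper: "\<And>x y. h y \<le> h x + g x \<bullet> (y - x) + K / 2 * (norm (y - x))\<^sup>2"
begin

text \<open>
  A Fenchel--Young inequality with quadratic gain. In the supremum defining the conjugate at \<open>z\<close>,
  the best point for the upper paraboloid at \<open>w\<close> is \<open>w + (z - g w) / K\<close>.
\<close>

lemma conjugate_lower_bound:
  "ereal (z \<bullet> w - h w + (norm (z - g w))\<^sup>2 / (2 * K)) \<le> fenchel_conjugate (\<lambda>x. ereal (h x)) z"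
proof -
  define d where "d = (1 / K) *\<^sub>R (z - g w)"
  have "(norm d)\<^sup>2 = (norm (z - g w))\<^sup>2 / K\<^sup>2" by (simp add: d_def power_mult_distrib power_divide)
  then have "K / 2 * (norm d)\<^sup>2 = (norm (z - g w))\<^sup>2 / (2 * K)"
    using K_pos by (simp add: power2_eq_square)
  moreover have "z \<bullet> d - g w \<bullet> d = (norm (z - g w))\<^sup>2 / K"
    by (simp add: d_def power2_norm_eq_inner inner_diff_left diff_divide_distrib)
  moreover have "(norm (z - g w))\<^sup>2 / K = 2 * ((norm (z - g w))\<^sup>2 / (2 * K))" by simp
  moreover have "h (w + d) \<le> h w + g w \<bullet> d + K / 2 * (norm d)\<^sup>2" using upper[where x = w and y = "w + d"] by simp
  ultimately have "z \<bullet> w - h w + (norm (z - g w))\<^sup>2 / (2 * K) \<le> z \<bullet> (w + d) - h (w + d)"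
    unfolding inner_add_right by linarith
  then show ?thesis
    unfolding fenchel_conjugate_def by (intro SUP_upper2[of "w + d"]) auto
qed

lemma conjugate_at_gradient:
  "fenchel_conjugate (\<lambda>x. ereal (h x)) (g w) = ereal (g w \<bullet> w - h w)"
proof (rule antisym)
  show "fenchel_conjugate (\<lambda>x. ereal (h x)) (g w) \<le> ereal (g w \<bullet> w - h w)"
    unfolding fenchel_conjugate_def
  proof (rule SUP_least)
    fix y show "ereal (g w \<bullet> y) - ereal (h y) \<le> ereal (g w \<bullet> w - h w)"
      using lower[of w y] by (simp add: inner_diff_right)
  qed
  show "ereal (g w \<bullet> w - h w) \<le> fenchel_conjugate (\<lambda>x. ereal (h x)) (g w)"
    using conjugate_lower_bound[of "g w" w] by simp
qed

text \<open>
  Subtracting the quadratic from the bound of \<open>conjugate_lower_bound\<close> leaves an affine function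
  of \<open>z\<close>, so the right-hand side is at most the left-hand side. Conversely these affine functions
  plus the quadratic dominate the functions \<open>z \<bullet> w - h w\<close> whose supremum is the conjugate. This
  expresses the \<open>1/K\<close>-strong convexity of the conjugate and shows lower semicontinuity
  at the same time.
\<close>

lemma conjugate_minus_quadratic_eq_SUP_affine:
  "fenchel_conjugate (\<lambda>x. ereal (h x)) z - ereal ((norm z)\<^sup>2 / (2 * K))
    = (SUP w. ereal (z \<bullet> (w - (1 / K) *\<^sub>R g w) + ((norm (g w))\<^sup>2 / (2 * K) - h w)))"
    (is "?P - ereal ?q = ?S")
proof -
  have affine: "z \<bullet> (w - (1 / K) *\<^sub>R g w) + ((norm (g w))\<^sup>2 / (2 * K) - h w)
      = z \<bullet> w - h w + (norm (z - g w))\<^sup>2 / (2 * K) - ?q" for w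
    using K_pos by (simp add: power2_norm_eq_inner inner_simps inner_commute field_simps)
  show ?thesis
  proof (rule antisym)
    have "?P \<le> ?S + ereal ?q"
      unfolding fenchel_conjugate_def
    proof (rule SUP_least)
      fix w
      have "ereal (z \<bullet> w) - ereal (h w)
          \<le> ereal (z \<bullet> (w - (1 / K) *\<^sub>R g w) + ((norm (g w))\<^sup>2 / (2 * K) - h w)) + ereal ?q"
        unfolding affine using K_pos by simp
      also have "\<dots> \<le> ?S + ereal ?q" by (intro add_right_mono SUP_upper) simp
      finally show "ereal (z \<bullet> w) - ereal (h w) \<le> ?S + ereal ?q" .
    qed
    then show "?P - ereal ?q \<le> ?S" by (simp add: ereal_minus_le_iff add.commute)
    show "?S \<le> ?P - ereal ?q"
    proof (rule SUP_least)
      fix w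
      have "ereal (z \<bullet> w - h w + (norm (z - g w))\<^sup>2 / (2 * K)) - ereal ?q \<le> ?P - ereal ?q"
        by (intro ereal_minus_mono conjugate_lower_bound) simp
      then show "ereal (z \<bullet> (w - (1 / K) *\<^sub>R g w) + ((norm (g w))\<^sup>2 / (2 * K) - h w)) \<le> ?P - ereal ?q"
        unfolding affine by simp
    qed
  qed
qed

text \<open>
  The conjugate is known exactly at \<open>g x\<close>; comparing this value with its lower bound taken from
  the point \<open>y\<close> strengthens the tangent inequality.
\<close>

lemma lower_improved:
  "h x + g x \<bullet> (y - x) + (norm (g x - g y))\<^sup>2 / (2 * K) \<le> h y"
  using order_trans[OF conjugate_lower_bound[of "g x" y], of "ereal (g x \<bullet> x - h x)"]
  by (simp add: conjugate_at_gradient inner_diff_right)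

text \<open>
  The Baillon--Haddad inequality: the two tangent inequalities, each improved by
  \<open>\<parallel>g x - g y\<parallel>\<^sup>2 / (2 K)\<close>, are added.
\<close>

lemma cocoercive: "(norm (g x - g y))\<^sup>2 / K \<le> (g x - g y) \<bullet> (x - y)"
  using lower_improved[of x y] lower_improved[of y x]
  by (simp add: norm_minus_commute[of "g y"] inner_simps field_simps)

lemma gradient_lipschitz: "K-lipschitz_on UNIV g"
proof (rule lipschitz_onI)
  fix x y
  have "(norm (g x - g y))\<^sup>2 \<le> K * ((g x - g y) \<bullet> (x - y))"
    using cocoercive[of x y] K_pos by (simp add: field_simps)
  also have "\<dots> \<le> K * (norm (g x - g y) * norm (x - y))"
    using K_pos by (intro mult_left_mono norm_cauchy_schwarz) simp
  finally have "norm (g x - g y) * norm (g x - g y) \<le> norm (g x - g y) * (K * norm (x - y))"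
    by (simp add: power2_eq_square mult_ac)
  then show "dist (g x) (g y) \<le> K * dist x y"
    using K_pos by (cases "norm (g x - g y) = 0") (auto simp: dist_norm)
qed (use K_pos in simp)

end

section \<open>Membership in \<open>Gamma0\<close>\<close>

lemma Gamma0_of_continuous_convex:
  assumes cont: "\<And>x. isCont h x" and conv: "convex_on UNIV h"
  shows "(\<lambda>x. ereal (h x)) \<in> Gamma0"
proof -
  have "lower_semicontinuous (\<lambda>x. ereal (h x))"
    unfolding lower_semicontinuous_def le_Liminf_iff
  proof (intro allI impI)
    fix x and c :: ereal assume "c < ereal (h x)"
    moreover have "((\<lambda>y. ereal (h y)) \<longlongrightarrow> ereal (h x)) (at x)"
      using cont[of x] by (simp add: isCont_def)
    ultimately show "\<forall>\<^sub>F y in at x. c < ereal (h y)" by (rule order_tendstoD(1)[rotated])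
  qed
  moreover have "convex_ereal (\<lambda>x. ereal (h x))"
    unfolding convex_ereal_def using conv by (auto simp: convex_on_def)
  ultimately show ?thesis by (auto simp: Gamma0_def proper_fun_def)
qed

lemma Gamma0_SUP_affine:
  fixes a :: "'i \<Rightarrow> 'a::real_inner" and b :: "'i \<Rightarrow> real"
  assumes finite_somewhere: "(SUP i. ereal (x0 \<bullet> a i + b i)) \<noteq> \<infinity>"
  shows "(\<lambda>x. SUP i. ereal (x \<bullet> a i + b i)) \<in> Gamma0" (is "?S \<in> _")
proof -
  have ge: "ereal (x \<bullet> a i + b i) \<le> ?S x" for x i by (rule SUP_upper) simp
  have "?S x \<noteq> - \<infinity>" for x using ge[of x undefined] by auto
  then have "proper_fun ?S" using finite_somewhere by (auto simp: proper_fun_def)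
  moreover have "lower_semicontinuous ?S"
    unfolding lower_semicontinuous_def le_Liminf_iff
  proof (intro allI impI)
    fix x c assume "c < ?S x"
    then obtain i where i: "c < ereal (x \<bullet> a i + b i)" by (auto simp: less_SUP_iff)
    have "((\<lambda>y. ereal (y \<bullet> a i + b i)) \<longlongrightarrow> ereal (x \<bullet> a i + b i)) (at x)"
      by (auto intro!: tendsto_eq_intros)
    from order_tendstoD(1)[OF this i] show "\<forall>\<^sub>F y in at x. c < ?S y"
      by eventually_elim (use ge less_le_trans in blast)
  qed
  moreover have "convex_ereal ?S"
    unfolding convex_ereal_def
  proof (intro allI impI, rule SUP_least)
    fix x y i and u v :: real assume uv: "0 < u" "0 < v" "u + v = 1"
    have "b i = u * b i + v * b i" using uv(3) by (simp flip: distrib_right)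
    then have "ereal ((u *\<^sub>R x + v *\<^sub>R y) \<bullet> a i + b i)
        = ereal u * ereal (x \<bullet> a i + b i) + ereal v * ereal (y \<bullet> a i + b i)"
      by (simp add: inner_simps algebra_simps)
    also have "\<dots> \<le> ereal u * ?S x + ereal v * ?S y"
      using uv by (intro add_mono ereal_mult_left_mono ge) auto
    finally show "ereal ((u *\<^sub>R x + v *\<^sub>R y) \<bullet> a i + b i) \<le> ereal u * ?S x + ereal v * ?S y" .
  qed
  ultimately show ?thesis by (simp add: Gamma0_def)
qed

section \<open>Forward-backward splitting\<close>

text \<open>
  Here \<open>F\<close> is the smooth part of the objective and \<open>penalty\<close> the convex part for which \<open>T\<close>, up to
  the scaling by \<open>\<beta>\<close>, is the proximity operator. The map \<open>step\<close> is a
  forward-backward step of size \<open>1 / \<beta>\<close>, and \<open>L < 2 * \<beta>\<close> is the usual condition that the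
  step size is below \<open>2 / L\<close>.
\<close>

locale forward_backward =
  backward: quadratic_sandwich \<psi> T "1 / \<beta>" + forward: quadratic_sandwich F G L
  for \<psi> F :: "'a::real_inner \<Rightarrow> real" and T G and \<beta> L +
  assumes step_size: "L < 2 * \<beta>"
begin

abbreviation penalty :: "'a \<Rightarrow> ereal" where
  "penalty x \<equiv> fenchel_conjugate (\<lambda>y. ereal (\<psi> y)) x - ereal (\<beta> / 2 * (norm x)\<^sup>2)"

definition step :: "'a \<Rightarrow> 'a" where
  "step x = T (\<beta> *\<^sub>R x - G x)"

lemma beta_pos: "\<beta> > 0"
  using backward.K_pos by simp

lemma penalty_Gamma0: "penalty \<in> Gamma0"
proof -
  have eq: "penalty z
      = (SUP w. ereal (z \<bullet> (w - \<beta> *\<^sub>R T w) + (\<beta> / 2 * (norm (T w))\<^sup>2 - \<psi> w)))" for z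
    using backward.conjugate_minus_quadratic_eq_SUP_affine[of z] by (simp add: mult.commute)
  have "penalty (T 0) \<noteq> \<infinity>" by (simp add: backward.conjugate_at_gradient)
  then show ?thesis unfolding eq by (rule Gamma0_SUP_affine)
qed

lemma penalty_lower_bound:
  "ereal (z \<bullet> w - \<psi> w + \<beta> / 2 * (norm (z - T w))\<^sup>2 - \<beta> / 2 * (norm z)\<^sup>2) \<le> penalty z"
  using ereal_minus_mono[OF backward.conjugate_lower_bound[of z w] order_refl[of "ereal (\<beta> / 2 * (norm z)\<^sup>2)"]]
  by (simp add: mult.commute)

lemma penalty_at_gradient:
  "penalty (T w) = ereal (T w \<bullet> w - \<psi> w - \<beta> / 2 * (norm (T w))\<^sup>2)"
  by (simp add: backward.conjugate_at_gradient)

text \<open>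
  By \<open>penalty_lower_bound\<close> the proximal objective is at least a constant plus \<open>\<parallel>y - T w\<parallel>\<^sup>2 / 2\<close>,
  because the other terms in \<open>y\<close> cancel; and the constant is attained at \<open>T w\<close>.
\<close>

lemma s_Prox_penalty:
  "s_Prox (\<lambda>x. ereal (1 / \<beta>) * penalty x) ((1 / \<beta>) *\<^sub>R w) = T w"
proof -
  define obj where "obj y = ereal (1 / \<beta>) * penalty y + ereal (1 / 2 * (norm ((1 / \<beta>) *\<^sub>R w - y))\<^sup>2)" for y
  define c where "c = (1 / \<beta>) * (1 / (2 * \<beta>) * (norm w)\<^sup>2 - \<psi> w)"
  have rescale: "(1 / \<beta>) * (y \<bullet> w - \<psi> w + r - \<beta> / 2 * (norm y)\<^sup>2) + 1 / 2 * (norm ((1 / \<beta>) *\<^sub>R w - y))\<^sup>2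
      = c + (1 / \<beta>) * r" for y r
    using beta_pos
    by (simp add: c_def power2_norm_eq_inner inner_simps inner_commute field_simps)
  have lower: "ereal (c + 1 / 2 * (norm (y - T w))\<^sup>2) \<le> obj y" for y
  proof -
    have "ereal (c + (1 / \<beta>) * (\<beta> / 2 * (norm (y - T w))\<^sup>2))
        = ereal (1 / \<beta>) * ereal (y \<bullet> w - \<psi> w + \<beta> / 2 * (norm (y - T w))\<^sup>2 - \<beta> / 2 * (norm y)\<^sup>2)
          + ereal (1 / 2 * (norm ((1 / \<beta>) *\<^sub>R w - y))\<^sup>2)"
      by (simp only: times_ereal.simps plus_ereal.simps rescale)
    also have "\<dots> \<le> obj y"
      unfolding obj_def using beta_pos by (intro add_right_mono ereal_mult_left_mono penalty_lower_bound) simp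
    finally show ?thesis using beta_pos by simp
  qed
  have attained: "obj (T w) = ereal c"
    unfolding obj_def penalty_at_gradient using rescale[of "T w" 0] by simp
  have "y \<in> minimizers obj \<longleftrightarrow> y = T w" for y
  proof
    assume "y \<in> minimizers obj"
    then have "obj y \<le> ereal c" using attained by (metis (mono_tags) minimizers_def mem_Collect_eq)
    then have "ereal (c + 1 / 2 * (norm (y - T w))\<^sup>2) \<le> ereal c" using lower order_trans by blast
    then show "y = T w" by simp
  next
    have "ereal c \<le> obj z" for z using lower[of z] by (rule order_trans[rotated]) simp
    moreover assume "y = T w"
    ultimately show "y \<in> minimizers obj" by (simp add: minimizers_def attained)
  qed
  then show ?thesis unfolding s_Prox_def obj_def[symmetric] by simp
qed

text \<open>
  The descent inequality of \<open>F\<close> costs \<open>L / 2\<close> times the squared step length, while the penalty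
  gains \<open>\<beta>\<close> times it.
\<close>

lemma step_decreases_objective:
  "ereal (F (step x)) + penalty (step x) + ereal ((\<beta> - L / 2) * (norm (step x - x))\<^sup>2)
    \<le> ereal (F x) + penalty x"
proof -
  define w s where "w = \<beta> *\<^sub>R x - G x" and "s = step x"
  have s: "s = T w" by (simp add: s_def step_def w_def)
  have quad: "G x \<bullet> (s - x) + s \<bullet> w - \<beta> / 2 * (norm s)\<^sup>2 + \<beta> * (norm (s - x))\<^sup>2
      = x \<bullet> w + \<beta> / 2 * (norm (x - s))\<^sup>2 - \<beta> / 2 * (norm x)\<^sup>2"
    by (simp add: w_def power2_norm_eq_inner inner_simps inner_commute field_simps)
  have "F s + (s \<bullet> w - \<psi> w - \<beta> / 2 * (norm s)\<^sup>2) + (\<beta> - L / 2) * (norm (s - x))\<^sup>2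
      \<le> F x + (x \<bullet> w - \<psi> w + \<beta> / 2 * (norm (x - s))\<^sup>2 - \<beta> / 2 * (norm x)\<^sup>2)"
    using forward.upper[of s x] quad unfolding left_diff_distrib by linarith
  then have "ereal (F s) + penalty s + ereal ((\<beta> - L / 2) * (norm (s - x))\<^sup>2)
      \<le> ereal (F x) + ereal (x \<bullet> w - \<psi> w + \<beta> / 2 * (norm (x - s))\<^sup>2 - \<beta> / 2 * (norm x)\<^sup>2)"
    unfolding s penalty_at_gradient by simp
  also have "\<dots> \<le> ereal (F x) + penalty x"
    unfolding s by (intro add_left_mono penalty_lower_bound)
  finally show ?thesis by (simp add: s_def)
qed

text \<open>
  A minimizer must be fixed, since otherwise the step would strictly decrease the objective.
  At a fixed point, the tangent inequality of \<open>F\<close> and the affine lower bound of the penalty add up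
  to optimality, because their slopes \<open>G x\<close> and \<open>- G x\<close> cancel.
\<close>

lemma minimizer_iff_fixed_point:
  "x \<in> minimizers (\<lambda>x. ereal (F x) + penalty x) \<longleftrightarrow> step x = x"
proof
  assume "x \<in> minimizers (\<lambda>x. ereal (F x) + penalty x)"
  then have "ereal (F x) + penalty x \<le> ereal (F (step x)) + penalty (step x)"
    unfolding minimizers_def by blast
  from order_trans[OF step_decreases_objective this]
  have "(\<beta> - L / 2) * (norm (step x - x))\<^sup>2 \<le> 0"
    unfolding step_def penalty_at_gradient by simp
  then show "step x = x" using step_size by (simp add: mult_le_0_iff)
next
  assume fixed: "step x = x"
  define w where "w = \<beta> *\<^sub>R x - G x"
  have x: "x = T w" using fixed by (simp add: step_def w_def)
  have "ereal (F x) + penalty x \<le> ereal (F y) + penalty y" for y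
  proof -
    have quad: "x \<bullet> w - \<beta> / 2 * (norm x)\<^sup>2
        = G x \<bullet> (y - x) + y \<bullet> w + \<beta> / 2 * (norm (y - x))\<^sup>2 - \<beta> / 2 * (norm y)\<^sup>2"
      by (simp add: w_def power2_norm_eq_inner inner_simps inner_commute field_simps)
    have "penalty x = ereal (x \<bullet> w - \<psi> w - \<beta> / 2 * (norm x)\<^sup>2)"
      using penalty_at_gradient[of w] by (simp flip: x)
    moreover have "F x + (x \<bullet> w - \<psi> w - \<beta> / 2 * (norm x)\<^sup>2)
        \<le> F y + (y \<bullet> w - \<psi> w + \<beta> / 2 * (norm (y - x))\<^sup>2 - \<beta> / 2 * (norm y)\<^sup>2)"
      using forward.lower[of x y] quad by linarith
    ultimately have "ereal (F x) + penalty x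
        \<le> ereal (F y) + ereal (y \<bullet> w - \<psi> w + \<beta> / 2 * (norm (y - x))\<^sup>2 - \<beta> / 2 * (norm y)\<^sup>2)"
      by simp
    also have "\<dots> \<le> ereal (F y) + penalty y"
      using penalty_lower_bound[of y w] by (intro add_left_mono) (simp flip: x)
    finally show ?thesis .
  qed
  then show "x \<in> minimizers (\<lambda>x. ereal (F x) + penalty x)" by (simp add: minimizers_def)
qed

text \<open>
  The step is the composition of the firmly nonexpansive map \<open>z \<mapsto> T (\<beta> z)\<close> with the gradient
  step \<open>x \<mapsto> x - G x / \<beta>\<close>. Both are averaged by cocoercivity, the second one because of the
  bound on the step size; the two defects are combined by hand below.
\<close>

lemma step_averaged:
  obtains \<alpha> where "\<alpha> > 0"
    and "\<And>x y. (norm (step x - step y))\<^sup>2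
      \<le> (norm (x - y))\<^sup>2 - \<alpha> * (norm ((x - step x) - (y - step y)))\<^sup>2"
proof -
  define p where "p = 1 / \<beta>"
  \<comment> \<open>The gradient step lowers squared distances by at least \<open>c * \<parallel>G x - G y\<parallel>\<^sup>2\<close>.\<close>
  define c where "c = p * (2 / L - p)"
  have p: "p > 0" "p * \<beta> = 1" using beta_pos by (auto simp: p_def)
  have c: "c > 0"
    using step_size beta_pos forward.K_pos by (auto simp: c_def p_def field_simps)
  show ?thesis
  proof (rule that)
    have cp: "c + p\<^sup>2 > 0" using c by (simp add: add_pos_nonneg)
    then show "c / (c + p\<^sup>2) > 0" using c by simp
    fix x y
    define e d s where "e = x - y" and "d = G x - G y" and "s = step x - step y"
    have T: "(norm s)\<^sup>2 \<le> s \<bullet> (e - p *\<^sub>R d)"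
    proof -
      have "\<beta> * (norm s)\<^sup>2 \<le> s \<bullet> (\<beta> *\<^sub>R e - d)"
        using backward.cocoercive[of "\<beta> *\<^sub>R x - G x" "\<beta> *\<^sub>R y - G y"]
        by (simp add: s_def step_def e_def d_def algebra_simps)
      then have "p * (\<beta> * (norm s)\<^sup>2) \<le> p * (s \<bullet> (\<beta> *\<^sub>R e - d))" using p by (intro mult_left_mono) auto
      also have "\<dots> = s \<bullet> ((p * \<beta>) *\<^sub>R e - p *\<^sub>R d)" by (simp add: inner_simps algebra_simps)
      finally show ?thesis using p by (simp flip: mult.assoc)
    qed
    have G: "(norm d)\<^sup>2 / L \<le> d \<bullet> e" using forward.cocoercive[of x y] by (simp add: d_def e_def)
    have firm: "(norm s)\<^sup>2 + c * (norm d)\<^sup>2 + (norm (e - s - p *\<^sub>R d))\<^sup>2 \<le> (norm e)\<^sup>2"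
    proof -
      have "(norm (e - s - p *\<^sub>R d))\<^sup>2 = (norm (e - p *\<^sub>R d))\<^sup>2 - 2 * (s \<bullet> (e - p *\<^sub>R d)) + (norm s)\<^sup>2"
        by (simp add: power2_norm_eq_inner inner_simps inner_commute algebra_simps)
      moreover have "(norm (e - p *\<^sub>R d))\<^sup>2 = (norm e)\<^sup>2 - 2 * p * (d \<bullet> e) + p\<^sup>2 * (norm d)\<^sup>2"
        unfolding power2_norm_eq_inner inner_diff_left inner_diff_right
        by (simp add: inner_commute[of e d] power2_eq_square algebra_simps)
      moreover have "c * (norm d)\<^sup>2 = 2 * p * ((norm d)\<^sup>2 / L) - p\<^sup>2 * (norm d)\<^sup>2"
        by (simp add: c_def power2_eq_square algebra_simps)
      moreover have "2 * p * ((norm d)\<^sup>2 / L) \<le> 2 * p * (d \<bullet> e)"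
        using G p by (intro mult_left_mono) auto
      ultimately show ?thesis using T by linarith
    qed
    \<comment> \<open>The displacement difference \<open>e - s\<close> is the sum of the backward defect and \<open>p *\<^sub>R d\<close>; a
      Cauchy--Schwarz inequality with weights \<open>1\<close> and \<open>p\<^sup>2 / c\<close> bounds it by the two defects in
      \<open>firm\<close>.\<close>
    have "c * (norm (e - s))\<^sup>2 \<le> (c + p\<^sup>2) * ((norm (e - s - p *\<^sub>R d))\<^sup>2 + c * (norm d)\<^sup>2)"
    proof -
      define v where "v = e - s - p *\<^sub>R d"
      have "e - s = v + p *\<^sub>R d" by (simp add: v_def)
      then have "(c + p\<^sup>2) * ((norm v)\<^sup>2 + c * (norm d)\<^sup>2) - c * (norm (e - s))\<^sup>2 = (norm (p *\<^sub>R v - c *\<^sub>R d))\<^sup>2"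
        unfolding power2_norm_eq_inner
        by (simp add: inner_simps inner_commute power2_eq_square algebra_simps)
      then show ?thesis
        using zero_le_power2[of "norm (p *\<^sub>R v - c *\<^sub>R d)"] unfolding v_def by linarith
    qed
    then have "c / (c + p\<^sup>2) * (norm (e - s))\<^sup>2 \<le> (norm (e - s - p *\<^sub>R d))\<^sup>2 + c * (norm d)\<^sup>2"
      using cp by (simp add: field_simps)
    then have "(norm s)\<^sup>2 \<le> (norm e)\<^sup>2 - c / (c + p\<^sup>2) * (norm (e - s))\<^sup>2" using firm by linarith
    moreover have "e - s = (x - step x) - (y - step y)" by (simp add: e_def s_def)
    ultimately have "(norm s)\<^sup>2
        \<le> (norm e)\<^sup>2 - c / (c + p\<^sup>2) * (norm ((x - step x) - (y - step y)))\<^sup>2" by simp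
    then show "(norm (step x - step y))\<^sup>2
        \<le> (norm (x - y))\<^sup>2 - c / (c + p\<^sup>2) * (norm ((x - step x) - (y - step y)))\<^sup>2"
      unfolding e_def s_def .
  qed
qed

end

section \<open>Transfer of strong convexity\<close>

lemma quadratic_sandwich_of_smooth_convex:
  fixes h :: "'a::{real_inner, complete_space} \<Rightarrow> real"
  assumes "K > 0" "convex_on UNIV h" "smooth_fun K h"
  shows "quadratic_sandwich h (gradient h) K"
proof
  have grad: "GDERIV h x :> gradient h x" for x
    using assms(3) by (simp add: smooth_fun_def GDERIV_gradient)
  show "h x + gradient h x \<bullet> (y - x) \<le> h y" for x y
    by (rule convex_above_tangent[OF assms(2) grad])
  show "h y \<le> h x + gradient h x \<bullet> (y - x) + K / 2 * (norm (y - x))\<^sup>2" for x y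
    using assms(3) by (intro descent_lemma grad) (simp add: smooth_fun_def)
qed fact

lemma GDERIV_minus_quadratic:
  assumes "GDERIV f x :> D"
  shows "GDERIV (\<lambda>x. f x - c / 2 * (norm x)\<^sup>2) x :> D - c *\<^sub>R x"
proof -
  have "((\<lambda>x. f x - c / 2 * (x \<bullet> x)) has_derivative (\<lambda>h. h \<bullet> D - c / 2 * (x \<bullet> h + h \<bullet> x))) (at x)"
    using assms unfolding gderiv_def by (auto intro!: derivative_eq_intros)
  then show ?thesis
    unfolding gderiv_def power2_norm_eq_inner by (simp add: inner_simps inner_commute)
qed

text \<open>
  Subtracting \<open>c / 2 * \<parallel>x\<parallel>\<^sup>2\<close> lowers the curvature of the upper paraboloids from \<open>\<kappa>\<close> to
  \<open>\<kappa> - c\<close>. This is why the shifted gradient has the smaller Lipschitz constant, which the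
  triangle inequality alone would not give.
\<close>

lemma quadratic_sandwich_of_strongly_convex_shift:
  fixes f :: "'a::{real_inner, complete_space} \<Rightarrow> real"
  assumes "smooth_fun \<kappa> f" and conv: "convex_on UNIV (\<lambda>x. f x - c / 2 * (norm x)\<^sup>2)"
    and "c < \<kappa>" and "\<mu> > 0"
  shows "quadratic_sandwich (\<lambda>x. \<mu> * (f x - c / 2 * (norm x)\<^sup>2))
    (\<lambda>x. \<mu> *\<^sub>R (gradient f x - c *\<^sub>R x)) (\<mu> * (\<kappa> - c))"
proof
  have grad: "GDERIV f x :> gradient f x" for x
    using assms(1) by (simp add: smooth_fun_def GDERIV_gradient)
  show "0 < \<mu> * (\<kappa> - c)" using assms by simp
  fix x y
  let ?h = "\<lambda>x. f x - c / 2 * (norm x)\<^sup>2"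
  have "\<mu> * (?h x + (gradient f x - c *\<^sub>R x) \<bullet> (y - x)) \<le> \<mu> * ?h y"
    using \<open>\<mu> > 0\<close>
    by (intro mult_left_mono convex_above_tangent[OF conv GDERIV_minus_quadratic[OF grad]]) simp
  then show "\<mu> * ?h x + \<mu> *\<^sub>R (gradient f x - c *\<^sub>R x) \<bullet> (y - x) \<le> \<mu> * ?h y"
    by (simp add: distrib_left)
  have "f y \<le> f x + gradient f x \<bullet> (y - x) + \<kappa> / 2 * (norm (y - x))\<^sup>2"
    using assms(1) by (intro descent_lemma grad) (simp add: smooth_fun_def)
  moreover have "c / 2 * (norm y)\<^sup>2
      = c / 2 * (norm x)\<^sup>2 + (c *\<^sub>R x) \<bullet> (y - x) + c / 2 * (norm (y - x))\<^sup>2"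
    by (simp add: power2_norm_eq_inner inner_simps inner_commute field_simps)
  ultimately have "?h y \<le> ?h x + (gradient f x - c *\<^sub>R x) \<bullet> (y - x) + (\<kappa> - c) / 2 * (norm (y - x))\<^sup>2"
    unfolding inner_diff_left diff_divide_distrib left_diff_distrib by linarith
  then have "\<mu> * ?h y
      \<le> \<mu> * (?h x + (gradient f x - c *\<^sub>R x) \<bullet> (y - x) + (\<kappa> - c) / 2 * (norm (y - x))\<^sup>2)"
    using \<open>\<mu> > 0\<close> by (intro mult_left_mono) auto
  then show "\<mu> * ?h y \<le> \<mu> * ?h x + \<mu> *\<^sub>R (gradient f x - c *\<^sub>R x) \<bullet> (y - x)
      + \<mu> * (\<kappa> - c) / 2 * (norm (y - x))\<^sup>2"
    by (simp add: distrib_left)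
qed

lemma strongly_convex_minus_quadratic:
  assumes "strongly_convex \<rho> f" "c \<le> \<rho>"
  shows "convex_on UNIV (\<lambda>x. f x - c / 2 * (norm x)\<^sup>2)"
proof (rule convex_onI)
  fix t :: real and x y :: 'a assume t: "0 < t" "t < 1"
  define z where "z = (1 - t) *\<^sub>R x + t *\<^sub>R y"
  define N where "N = (1 - t) * (norm x)\<^sup>2 + t * (norm y)\<^sup>2 - t * (1 - t) * (norm (x - y))\<^sup>2"
  have "f z - \<rho> / 2 * (norm z)\<^sup>2
      \<le> (1 - t) * (f x - \<rho> / 2 * (norm x)\<^sup>2) + t * (f y - \<rho> / 2 * (norm y)\<^sup>2)"
    unfolding z_def using convex_onD[OF assms(1)[unfolded strongly_convex_def], of t x y] t by simp
  moreover have N: "(norm z)\<^sup>2 = N"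
    unfolding z_def N_def power2_norm_eq_inner
    by (simp add: inner_simps inner_commute power2_eq_square algebra_simps)
  moreover have "0 \<le> (\<rho> - c) / 2 * (t * (1 - t) * (norm (x - y))\<^sup>2)" using assms(2) t by simp
  ultimately show "f ((1 - t) *\<^sub>R x + t *\<^sub>R y) - c / 2 * (norm ((1 - t) *\<^sub>R x + t *\<^sub>R y))\<^sup>2
      \<le> (1 - t) * (f x - c / 2 * (norm x)\<^sup>2) + t * (f y - c / 2 * (norm y)\<^sup>2)"
    unfolding z_def[symmetric] N unfolding N_def by (simp add: algebra_simps diff_divide_distrib)
qed simp

theorem theorem2:
  fixes f \<psi> f_hat :: "'a::{real_inner, complete_space} \<Rightarrow> real"
    and T :: "'a \<Rightarrow> 'a"
    and \<phi> \<phi>_check :: "'a \<Rightarrow> ereal"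
    and \<kappa> \<rho> \<beta> \<mu> L :: real
  assumes f_Gamma0: "(\<lambda>x. ereal (f x)) \<in> Gamma0"
    and f_smooth: "smooth_fun \<kappa> f"
    and f_strongly_convex: "strongly_convex \<rho> f"
    and kappa_rho: "\<kappa> > \<rho>" "\<rho> > 0"
    and beta: "\<beta> \<in> {(\<kappa> - \<rho>) / (\<kappa> + \<rho>)<..<1}"
    and psi_convex: "convex_on UNIV \<psi>"
    and psi_smooth: "smooth_fun (inverse \<beta>) \<psi>"
    and T_eq: "T = gradient \<psi>"
    and mu: "\<mu> \<in> {(1 - \<beta>) / \<rho>..<(1 + \<beta>) / \<kappa>}"
    and phi_eq: "\<phi> = (\<lambda>x. fenchel_conjugate (\<lambda>y. ereal (\<psi> y)) x - ereal (1 / 2 * (norm x)\<^sup>2))"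
    and f_hat_eq: "f_hat = (\<lambda>x. f x - (1 - \<beta>) / (2 * \<mu>) * (norm x)\<^sup>2)"
    and phi_check_eq: "\<phi>_check = (\<lambda>x. \<phi> x + ereal ((1 - \<beta>) / 2 * (norm x)\<^sup>2))"
    and L_eq: "L = \<mu> * \<kappa> - (1 - \<beta>)"
  shows
    "((\<lambda>x. ereal (f_hat x)) \<in> Gamma0
      \<and> \<phi>_check \<in> Gamma0
      \<and> (\<lambda>x. ereal (\<mu> * f_hat x) + \<phi>_check x) = (\<lambda>x. ereal (\<mu> * f x) + \<phi> x)
      \<and> (\<forall>x. f_hat differentiable (at x))
      \<and> T \<circ> (\<lambda>x. x - \<mu> *\<^sub>R gradient f x)
          = s_Prox (\<lambda>x. ereal (inverse \<beta>) * \<phi>_check x)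
            \<circ> (\<lambda>x. x - (inverse \<beta> * \<mu>) *\<^sub>R gradient f_hat x)
      \<and> L > 0
      \<and> L-lipschitz_on UNIV (\<lambda>x. \<mu> *\<^sub>R gradient f_hat x)
      \<and> inverse \<beta> \<in> {1<..<2 / L})
    \<and> (minimizers (\<lambda>x. ereal (\<mu> * f x) + \<phi> x) \<noteq> {} \<longrightarrow>
        (\<forall>x0. \<forall>x :: nat \<Rightarrow> 'a.
          x 0 = x0 \<and> (\<forall>k. x (Suc k) = T (x k - \<mu> *\<^sub>R gradient f (x k))) \<longrightarrow>
          (\<exists>x_hat \<in> minimizers (\<lambda>x. ereal (\<mu> * f x) + \<phi> x). converges_weakly x x_hat)))"
proof -
  have "\<beta> > 0"
  proof -
    have "(\<kappa> - \<rho>) / (\<kappa> + \<rho>) > 0" using kappa_rho by simp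
    then show ?thesis using beta by simp
  qed
  have "\<beta> < 1" using beta by simp
  have "\<mu> > 0"
    using mu kappa_rho \<open>\<beta> < 1\<close> by (auto intro: less_le_trans[rotated])
  \<comment> \<open>The amount of strong convexity moved from \<open>f\<close> to the penalty; the lower bound on \<open>\<mu>\<close> says
    that \<open>f\<close> has that much to give.\<close>
  define c where "c = (1 - \<beta>) / \<mu>"
  have mu_c: "\<mu> * c = 1 - \<beta>" using \<open>\<mu> > 0\<close> by (simp add: c_def)
  have "c \<le> \<rho>" using mu kappa_rho \<open>\<mu> > 0\<close> by (simp add: c_def field_simps)
  have L: "L = \<mu> * (\<kappa> - c)" by (simp add: L_eq right_diff_distrib mu_c)
  have f_hat: "f_hat = (\<lambda>x. f x - c / 2 * (norm x)\<^sup>2)" by (simp add: f_hat_eq c_def mult.commute)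
  have conv: "convex_on UNIV f_hat"
    unfolding f_hat by (rule strongly_convex_minus_quadratic[OF f_strongly_convex \<open>c \<le> \<rho>\<close>])
  have grad: "GDERIV f_hat x :> gradient f x - c *\<^sub>R x" for x
    unfolding f_hat using f_smooth
    by (intro GDERIV_minus_quadratic GDERIV_gradient) (simp add: smooth_fun_def)
  have grad_f_hat: "gradient f_hat x = gradient f x - c *\<^sub>R x" for x
    by (rule gradient_eqI[OF grad])
  have diff: "f_hat differentiable (at x)" for x
    using grad[of x] by (auto simp: gderiv_def differentiable_def)
  \<comment> \<open>The upper bound on \<open>\<mu>\<close> is the step-size condition \<open>L < 2 * \<beta>\<close>.\<close>
  have "\<mu> * \<kappa> < 1 + \<beta>" using mu kappa_rho by (simp add: field_simps)
  interpret forward_backward \<psi> "\<lambda>x. \<mu> * f_hat x" T "\<lambda>x. \<mu> *\<^sub>R gradient f_hat x" \<beta> L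
  proof (rule forward_backward.intro)
    show "quadratic_sandwich \<psi> T (1 / \<beta>)"
      unfolding T_eq using \<open>\<beta> > 0\<close> psi_convex psi_smooth
      by (intro quadratic_sandwich_of_smooth_convex) (simp_all add: inverse_eq_divide)
    show "quadratic_sandwich (\<lambda>x. \<mu> * f_hat x) (\<lambda>x. \<mu> *\<^sub>R gradient f_hat x) L"
      unfolding grad_f_hat unfolding f_hat L
      using conv \<open>c \<le> \<rho>\<close> kappa_rho \<open>\<mu> > 0\<close>
      by (intro quadratic_sandwich_of_strongly_convex_shift f_smooth) (auto simp: f_hat)
    show "forward_backward_axioms \<beta> L"
      using \<open>\<mu> * \<kappa> < 1 + \<beta>\<close> by unfold_locales (simp add: L_eq)
  qed
  have penalty: "\<phi>_check = penalty"
  proof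
    fix x
    show "\<phi>_check x = penalty x"
      unfolding phi_check_eq phi_eq
      by (cases "fenchel_conjugate (\<lambda>y. ereal (\<psi> y)) x") (simp_all add: field_simps)
  qed
  have split: "(\<lambda>x. ereal (\<mu> * f_hat x) + \<phi>_check x) = (\<lambda>x. ereal (\<mu> * f x) + \<phi> x)"
  proof
    fix x
    have "\<mu> * f_hat x = \<mu> * f x - (1 - \<beta>) / 2 * (norm x)\<^sup>2"
      using \<open>\<mu> > 0\<close> by (simp add: f_hat_eq right_diff_distrib)
    then show "ereal (\<mu> * f_hat x) + \<phi>_check x = ereal (\<mu> * f x) + \<phi> x"
      unfolding phi_check_eq by (cases "\<phi> x") simp_all
  qed
  have step: "step x = T (x - \<mu> *\<^sub>R gradient f x)" for x
  proof -
    have "\<beta> *\<^sub>R x - \<mu> *\<^sub>R gradient f_hat x = (\<beta> + \<mu> * c) *\<^sub>R x - \<mu> *\<^sub>R gradient f x"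
      unfolding grad_f_hat by (simp add: algebra_simps)
    then show ?thesis by (simp add: step_def mu_c)
  qed
  have f_hat_Gamma0: "(\<lambda>x. ereal (f_hat x)) \<in> Gamma0"
    by (intro Gamma0_of_continuous_convex conv differentiable_imp_continuous_within diff)
  have prox: "T \<circ> (\<lambda>x. x - \<mu> *\<^sub>R gradient f x)
      = s_Prox (\<lambda>x. ereal (inverse \<beta>) * \<phi>_check x)
        \<circ> (\<lambda>x. x - (inverse \<beta> * \<mu>) *\<^sub>R gradient f_hat x)"
  proof
    fix x
    have "x - (inverse \<beta> * \<mu>) *\<^sub>R gradient f_hat x
        = (1 / \<beta>) *\<^sub>R (\<beta> *\<^sub>R x - \<mu> *\<^sub>R gradient f_hat x)"
      using \<open>\<beta> > 0\<close> by (simp add: scaleR_diff_right inverse_eq_divide)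
    then show "(T \<circ> (\<lambda>x. x - \<mu> *\<^sub>R gradient f x)) x
        = (s_Prox (\<lambda>x. ereal (inverse \<beta>) * \<phi>_check x)
          \<circ> (\<lambda>x. x - (inverse \<beta> * \<mu>) *\<^sub>R gradient f_hat x)) x"
      using s_Prox_penalty[of "\<beta> *\<^sub>R x - \<mu> *\<^sub>R gradient f_hat x"] step[of x]
      by (simp add: penalty step_def inverse_eq_divide)
  qed
  have step_range: "inverse \<beta> \<in> {1<..<2 / L}"
    using \<open>\<beta> > 0\<close> \<open>\<beta> < 1\<close> step_size forward.K_pos by (simp add: field_simps)
  have weak: "\<exists>x_hat \<in> minimizers (\<lambda>x. ereal (\<mu> * f x) + \<phi> x). converges_weakly x x_hat"
    if nonempty: "minimizers (\<lambda>x. ereal (\<mu> * f x) + \<phi> x) \<noteq> {}"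
      and iterate: "\<And>k. x (Suc k) = T (x k - \<mu> *\<^sub>R gradient f (x k))" for x
  proof -
    have fixed_iff: "y \<in> minimizers (\<lambda>x. ereal (\<mu> * f x) + \<phi> x) \<longleftrightarrow> step y = y" for y
      using minimizer_iff_fixed_point[of y] unfolding split[symmetric] penalty .
    obtain q where "q \<in> minimizers (\<lambda>x. ereal (\<mu> * f x) + \<phi> x)" using nonempty by auto
    then have q: "step q = q" by (simp only: fixed_iff)
    obtain \<alpha> where \<alpha>: "\<alpha> > 0" "\<And>y z. (norm (step y - step z))\<^sup>2
        \<le> (norm (y - z))\<^sup>2 - \<alpha> * (norm ((y - step y) - (z - step z)))\<^sup>2"
      by (rule step_averaged) blast
    have "x (Suc k) = step (x k)" for k unfolding step by (rule iterate)
    then obtain p where "step p = p" "converges_weakly x p"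
      by (rule averaged_iteration_converges_weakly[where S = step, OF \<alpha> q])
    then show ?thesis by (intro bexI[of _ p]) (simp_all only: fixed_iff)
  qed
  have phi_check_Gamma0: "\<phi>_check \<in> Gamma0"
    unfolding penalty by (rule penalty_Gamma0)
  show ?thesis
    by (intro conjI impI allI f_hat_Gamma0 phi_check_Gamma0 split diff prox forward.K_pos
        forward.gradient_lipschitz step_range weak) simp_all
qed

end
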